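(* Let $\Omega\subset\mathbb{R}^d$ be convex and compact with non-empty interior, and let $\mathcal{H}$ be equal to the (fractional) Sobolev space $H^m=H^m(\Omega)$ with equivalent norms, where $m>d/2$. Suppose the design satisfies the norm-comparison property with constants $C_1$, $C_\epsilon$ and events $\Xi_\epsilon$. Let $g\in\mathcal{H}$ be such that: (i) there exist $C_g>0$ and $\delta\in(0,1]$ with $|\langle g,v\rangle_{\mathcal{H}}|\le C_g\|v\|_{L_2}^{\delta}\|v\|_{\mathcal{H}}^{1-\delta}$ for every $v\in\mathcal{H}$; (ii) for some $\tau\in(0,1]$ there exist $C_0>0$, $R_0>0$ such that for each $R\ge R_0$, $$\sup_{v\in\mathcal H:\ \|v\|_{\mathcal H}\le R\|v\|_{L_2}}\frac{\langle g,v\rangle_{\mathcal H}}{\|v\|_{L_2}}>C_0R^{1-\tau}.$$ Then for each $\epsilon>0$ there exist constants $A_1,A_2,A_3>0$ depending only on $C_0,C_1,C_g,C_\epsilon,R_0,\delta,\tau$ such that, on the event $\Xi_\epsilon$, for any $n$ and $\lambda$ satisfying $A_1n^{-2m/d}\le\lambda\le A_2$, $$\mathrm{VAR}\ge A_3\sigma^2n^{-1}\lambda^{\frac{\delta(\tau-1)}{\tau}}.$$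
   Context: Setting: $K$ is a reproducing kernel on $\Omega\subset\mathbb{R}^d$ with reproducing kernel Hilbert space $\mathcal{H}$ (norm $\|\cdot\|_{\mathcal H}$, inner product $\langle\cdot,\cdot\rangle_{\mathcal H}$). For each $n$ there are design points $x_1,\dots,x_n\in\Omega$ (deterministic or random, may depend on $n$) and data $y_i=f(x_i)+e_i$, with $f\in\mathcal{H}$ and $e_1,e_2,\dots$ i.i.d. with mean zero and finite variance $\sigma^2$; the errors are independent of the design. Write $X=(x_1,\dots,x_n)^T$, $E=(e_1,\dots,e_n)^T$, $K(A,B)=(K(a_i,b_j))_{ij}$, $g(X)=(g(x_1),\dots,g(x_n))^T$. The smoothing parameter is $\lambda>0$. The kernel ridge regression (KRR) estimator is $\hat f=\operatorname{argmin}_{v\in\mathcal{H}}\frac1n\sum_{i=1}^n(y_i-v(x_i))^2+\lambda\|v\|_{\mathcal{H}}^2$. Let $\operatorname{Var}_E$ be the variance with respect to $E$ only ($X$ held fixed). For $g\in\mathcal H$, $$\mathrm{VAR}:=\operatorname{Var}_E\langle\hat f-f,g\rangle_{\mathcal H}=\sigma^2g^T(X)(K(X,X)+\lambda nI)^{-2}g(X).$$ Also $\|v\|_n^2=\frac1n\sum_{i=1}^n v(x_i)^2$, and $\|\cdot\|_{L_2}$ is the $L_2(\Omega)$ norm. Convention: $0/0=0$. Norm-comparison property of the design: $X$, if random, is independent of $E$; and there is $C_1>0$, and for each $\epsilon>0$ a $C_\epsilon>0$, all independent of $n$ and $X$, such that $\mathbb{P}(\Xi_\epsilon)\ge1-\epsilon$,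 where $\Xi_\epsilon$ (depending on $n$) is the event that, for all $v\in\mathcal H$, $\|v\|_{L_2}\le\max\{C_1\|v\|_n,C_\epsilon n^{-m/d}\|v\|_{\mathcal H}\}$ and $\|v\|_n\le\max\{C_1\|v\|_{L_2},C_\epsilon n^{-m/d}\|v\|_{\mathcal H}\}$ (for deterministic $X$ these inequalities hold unconditionally). *)

theory Defs
  imports "HOL-Probability.Probability"
begin

section \<open>The space \<open>R^d\<close> with \<open>d\<close> a natural number\<close>

text \<open>The dimension has to be quantified inside the theorem, below the constants that do not
  depend on it.  So \<open>R^d\<close> is the library's \<^const>\<open>Euclidean_space\<close>: sequences that vanish at all
  indices \<open>i \<ge> d\<close>, with the topology of coordinatewise convergence.\<close>

type_synonym point = "nat \<Rightarrow> real"

abbreviation Rd :: "nat \<Rightarrow> point set" where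
  "Rd d \<equiv> topspace (Euclidean_space d)"

definition convex_Rd :: "point set \<Rightarrow> bool" where
  "convex_Rd S \<longleftrightarrow>
     (\<forall>x\<in>S. \<forall>y\<in>S. \<forall>t\<in>{0..1}. (\<lambda>i. (1 - t) * x i + t * y i) \<in> S)"

definition dist_Rd :: "nat \<Rightarrow> point \<Rightarrow> point \<Rightarrow> real" where
  "dist_Rd d x y = L2_set (\<lambda>i. x i - y i) {..<d}"

text \<open>Lebesgue measure of \<open>R^d\<close> on Borel sets.  Elements of the product space are
  \<^const>\<open>undefined\<close> at the indices \<open>i \<ge> d\<close>, which are reset to \<open>0\<close> here.\<close>

definition lebesgue_Rd :: "nat \<Rightarrow> point measure" where
  "lebesgue_Rd d =
     distr (Pi\<^sub>M {..<d} (\<lambda>_. lborel)) borel (\<lambda>x i. if i < d then x i else 0)"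

definition L2_norm :: "nat \<Rightarrow> point set \<Rightarrow> (point \<Rightarrow> real) \<Rightarrow> real" where
  "L2_norm d \<Omega> v = sqrt (set_lebesgue_integral (lebesgue_Rd d) \<Omega> (\<lambda>x. (v x)\<^sup>2))"


section \<open>Sobolev spaces of real order\<close>

definition partial :: "nat \<Rightarrow> (point \<Rightarrow> real) \<Rightarrow> point \<Rightarrow> real" where
  "partial i \<phi> x = deriv (\<lambda>t. \<phi> (x(i := t))) (x i)"

text \<open>\<open>partials [i\<^sub>1, \<dots>, i\<^sub>k] \<phi>\<close> is the classical iterated partial derivative
  \<open>\<partial>\<^bsub>i\<^sub>1\<^esub> \<dots> \<partial>\<^bsub>i\<^sub>k\<^esub> \<phi>\<close>.\<close>

definition partials :: "nat list \<Rightarrow> (point \<Rightarrow> real) \<Rightarrow> point \<Rightarrow> real" where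
  "partials js \<phi> = foldr partial js \<phi>"

definition smooth_Rd :: "nat \<Rightarrow> (point \<Rightarrow> real) \<Rightarrow> bool" where
  "smooth_Rd d \<phi> \<longleftrightarrow>
     (\<forall>js \<in> lists {..<d}.
        continuous_map (Euclidean_space d) euclideanreal (partials js \<phi>) \<and>
        (\<forall>i<d. \<forall>x \<in> Rd d. (\<lambda>t. partials js \<phi> (x(i := t))) differentiable at (x i)))"

definition test_function :: "nat \<Rightarrow> point set \<Rightarrow> (point \<Rightarrow> real) \<Rightarrow> bool" where
  "test_function d U \<phi> \<longleftrightarrow>
     smooth_Rd d \<phi> \<and>
     (\<exists>S. compactin (Euclidean_space d) S \<and> S \<subseteq> U \<and> (\<forall>x \<in> Rd d - S. \<phi> x = 0))"

text \<open>A multi-index of order \<open>k\<close> in dimension \<open>d\<close> is represented by the sorted list of length \<open>k\<close>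
  in which every \<open>i < d\<close> occurs as often as the multi-index says.\<close>

definition multi_indices :: "nat \<Rightarrow> nat \<Rightarrow> nat list set" where
  "multi_indices d k = {js \<in> lists {..<d}. sorted js \<and> length js = k}"

text \<open>\<open>u\<close> is a square-integrable weak derivative of \<open>v\<close> on the open set \<open>U\<close>.\<close>

definition is_weak_deriv ::
  "nat \<Rightarrow> point set \<Rightarrow> nat list \<Rightarrow> (point \<Rightarrow> real) \<Rightarrow> (point \<Rightarrow> real) \<Rightarrow> bool" where
  "is_weak_deriv d U js v u \<longleftrightarrow>
     u \<in> borel_measurable borel \<and>
     set_integrable (lebesgue_Rd d) U (\<lambda>x. (u x)\<^sup>2) \<and>
     (\<forall>\<phi>. test_function d U \<phi> \<longrightarrow>
        set_lebesgue_integral (lebesgue_Rd d) U (\<lambda>x. v x * partials js \<phi> x) =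
        (- 1) ^ length js * set_lebesgue_integral (lebesgue_Rd d) U (\<lambda>x. u x * \<phi> x))"

text \<open>Weak derivatives are unique up to null sets; the choice does not affect the integrals
  below.\<close>

definition weak_deriv ::
  "nat \<Rightarrow> point set \<Rightarrow> nat list \<Rightarrow> (point \<Rightarrow> real) \<Rightarrow> point \<Rightarrow> real" where
  "weak_deriv d U js v = (SOME u. is_weak_deriv d U js v u)"

text \<open>The squared Sobolev-Slobodeckij norm of order \<open>m = k + s\<close> with \<open>k = \<lfloor>m\<rfloor>\<close> and
  \<open>0 \<le> s < 1\<close>.  There is no double integral for integer \<open>m\<close>.\<close>

definition sobolev_sq_norm ::
  "nat \<Rightarrow> real \<Rightarrow> point set \<Rightarrow> (point \<Rightarrow> real) \<Rightarrow> ennreal" where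
  "sobolev_sq_norm d m U v =
     (\<Sum>k\<le>nat \<lfloor>m\<rfloor>. \<Sum>js\<in>multi_indices d k.
        \<integral>\<^sup>+x\<in>U. ennreal ((weak_deriv d U js v x)\<^sup>2) \<partial>lebesgue_Rd d) +
     (if m \<in> \<int> then 0 else
        \<Sum>js\<in>multi_indices d (nat \<lfloor>m\<rfloor>).
          \<integral>\<^sup>+x\<in>U. (\<integral>\<^sup>+y\<in>U.
             ennreal ((weak_deriv d U js v x - weak_deriv d U js v y)\<^sup>2 /
                      dist_Rd d x y powr (real d + 2 * frac m)) \<partial>lebesgue_Rd d) \<partial>lebesgue_Rd d)"

definition sobolev_norm ::
  "nat \<Rightarrow> real \<Rightarrow> point set \<Rightarrow> (point \<Rightarrow> real) \<Rightarrow> real" where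
  "sobolev_norm d m \<Omega> v =
     sqrt (enn2real (sobolev_sq_norm d m (Euclidean_space d interior_of \<Omega>) v))"

text \<open>\<open>H^m(\<Omega>)\<close> as a space of functions on \<open>\<Omega>\<close>, for \<open>m > d/2\<close> and \<open>\<Omega>\<close> convex and compact with
  non-empty interior.  By the Sobolev embedding every class has a unique representative that is
  continuous on \<open>\<Omega>\<close>, and point evaluation refers to this one.  Functions on \<open>\<Omega>\<close> are extended by
  \<open>0\<close>.\<close>

definition sobolev_space :: "nat \<Rightarrow> real \<Rightarrow> point set \<Rightarrow> (point \<Rightarrow> real) set" where
  "sobolev_space d m \<Omega> =
     {v. (\<forall>x. x \<notin> \<Omega> \<longrightarrow> v x = 0) \<and>
         continuous_map (subtopology (Euclidean_space d) \<Omega>) euclideanreal v \<and>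
         (\<forall>k\<le>nat \<lfloor>m\<rfloor>. \<forall>js\<in>multi_indices d k.
            \<exists>u. is_weak_deriv d (Euclidean_space d interior_of \<Omega>) js v u) \<and>
         sobolev_sq_norm d m (Euclidean_space d interior_of \<Omega>) v < \<infinity>}"


section \<open>Reproducing kernel Hilbert spaces\<close>

definition ip_norm :: "(('x \<Rightarrow> real) \<Rightarrow> ('x \<Rightarrow> real) \<Rightarrow> real) \<Rightarrow> ('x \<Rightarrow> real) \<Rightarrow> real" where
  "ip_norm ip v = sqrt (ip v v)"

text \<open>The real Hilbert space \<open>H\<close> of functions on \<open>\<Omega>\<close> (extended by \<open>0\<close>) with inner product \<open>ip\<close>
  and reproducing kernel \<open>K\<close>.\<close>

locale rkhs =
  fixes \<Omega> :: "'x set"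
    and K :: "'x \<Rightarrow> 'x \<Rightarrow> real"
    and H :: "('x \<Rightarrow> real) set"
    and ip :: "('x \<Rightarrow> real) \<Rightarrow> ('x \<Rightarrow> real) \<Rightarrow> real"
  assumes vanish: "\<lbrakk>v \<in> H; x \<notin> \<Omega>\<rbrakk> \<Longrightarrow> v x = 0"
    and zero_mem: "(\<lambda>_. 0) \<in> H"
    and add_mem: "\<lbrakk>v \<in> H; w \<in> H\<rbrakk> \<Longrightarrow> (\<lambda>x. v x + w x) \<in> H"
    and scale_mem: "v \<in> H \<Longrightarrow> (\<lambda>x. c * v x) \<in> H"
    and ip_commute: "\<lbrakk>v \<in> H; w \<in> H\<rbrakk> \<Longrightarrow> ip v w = ip w v"
    and ip_add: "\<lbrakk>u \<in> H; v \<in> H; w \<in> H\<rbrakk> \<Longrightarrow> ip (\<lambda>x. u x + v x) w = ip u w + ip v w"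
    and ip_scale: "\<lbrakk>v \<in> H; w \<in> H\<rbrakk> \<Longrightarrow> ip (\<lambda>x. c * v x) w = c * ip v w"
    and ip_pos: "\<lbrakk>v \<in> H; v \<noteq> (\<lambda>_. 0)\<rbrakk> \<Longrightarrow> ip v v > 0"
    and complete:
      "\<lbrakk>\<And>n. s n \<in> H;
        \<And>r. r > 0 \<Longrightarrow> \<exists>N. \<forall>i\<ge>N. \<forall>j\<ge>N. ip_norm ip (\<lambda>x. s i x - s j x) < r\<rbrakk>
       \<Longrightarrow> \<exists>l\<in>H. (\<lambda>n. ip_norm ip (\<lambda>x. s n x - l x)) \<longlonglongrightarrow> 0"
    and kernel_mem: "y \<in> \<Omega> \<Longrightarrow> (\<lambda>x. if x \<in> \<Omega> then K x y else 0) \<in> H"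
    and reproducing: "\<lbrakk>v \<in> H; y \<in> \<Omega>\<rbrakk> \<Longrightarrow> ip v (\<lambda>x. if x \<in> \<Omega> then K x y else 0) = v y"

definition equal_sobolev ::
  "nat \<Rightarrow> real \<Rightarrow> point set \<Rightarrow> (point \<Rightarrow> real) set \<Rightarrow>
   ((point \<Rightarrow> real) \<Rightarrow> (point \<Rightarrow> real) \<Rightarrow> real) \<Rightarrow> bool" where
  "equal_sobolev d m \<Omega> H ip \<longleftrightarrow>
     H = sobolev_space d m \<Omega> \<and>
     (\<exists>a>0. \<exists>b>0. \<forall>v\<in>H.
        a * sobolev_norm d m \<Omega> v \<le> ip_norm ip v \<and> ip_norm ip v \<le> b * sobolev_norm d m \<Omega> v)"


section \<open>Kernel ridge regression\<close>

text \<open>The design points and the data are \<open>xs 0, \<dots>, xs (n - 1)\<close> and \<open>ys 0, \<dots>, ys (n - 1)\<close>.\<close>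

definition emp_norm :: "nat \<Rightarrow> (nat \<Rightarrow> 'x) \<Rightarrow> ('x \<Rightarrow> real) \<Rightarrow> real" where
  "emp_norm n xs v = sqrt ((\<Sum>i<n. (v (xs i))\<^sup>2) / real n)"

definition krr ::
  "('x \<Rightarrow> real) set \<Rightarrow> (('x \<Rightarrow> real) \<Rightarrow> ('x \<Rightarrow> real) \<Rightarrow> real) \<Rightarrow>
   nat \<Rightarrow> real \<Rightarrow> (nat \<Rightarrow> 'x) \<Rightarrow> (nat \<Rightarrow> real) \<Rightarrow> 'x \<Rightarrow> real" where
  "krr H ip n lam xs ys =
     arg_min (\<lambda>v. (\<Sum>i<n. (ys i - v (xs i))\<^sup>2) / real n + lam * (ip_norm ip v)\<^sup>2) (\<lambda>v. v \<in> H)"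

text \<open>The variance of the inner product of \<open>krr - f\<close> with \<open>g\<close> with respect to the errors
  \<open>e i\<close> only: the design points \<open>xs\<close> are held fixed.\<close>

definition krr_var ::
  "'w measure \<Rightarrow> (nat \<Rightarrow> 'w \<Rightarrow> real) \<Rightarrow> ('x \<Rightarrow> real) set \<Rightarrow>
   (('x \<Rightarrow> real) \<Rightarrow> ('x \<Rightarrow> real) \<Rightarrow> real) \<Rightarrow> nat \<Rightarrow> real \<Rightarrow> (nat \<Rightarrow> 'x) \<Rightarrow>
   ('x \<Rightarrow> real) \<Rightarrow> ('x \<Rightarrow> real) \<Rightarrow> real" where
  "krr_var M e H ip n lam xs f g =
     prob_space.variance M
       (\<lambda>\<omega>. ip (\<lambda>x. krr H ip n lam xs (\<lambda>i. f (xs i) + e i \<omega>) x - f x) g)"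

definition iid_errors :: "'w measure \<Rightarrow> (nat \<Rightarrow> 'w \<Rightarrow> real) \<Rightarrow> real \<Rightarrow> bool" where
  "iid_errors M e \<sigma> \<longleftrightarrow>
     prob_space.indep_vars M (\<lambda>_. borel) e UNIV \<and>
     (\<forall>i. distr M borel (e i) = distr M borel (e 0)) \<and>
     (\<forall>i. integrable M (e i) \<and> integrable M (\<lambda>\<omega>. (e i \<omega>)\<^sup>2) \<and>
          prob_space.expectation M (e i) = 0 \<and> prob_space.variance M (e i) = \<sigma>\<^sup>2)"

text \<open>\<open>X n i \<omega>\<close> for \<open>i < n\<close> are the design points of the sample of size \<open>n\<close>.  A deterministic
  design is one that is constant in \<open>\<omega>\<close>.  Independence from the errors is that of the generated sigma-algebras.\<close>

definition design ::
  "'w measure \<Rightarrow> point set \<Rightarrow> (nat \<Rightarrow> 'w \<Rightarrow> real) \<Rightarrow> (nat \<Rightarrow> nat \<Rightarrow> 'w \<Rightarrow> point) \<Rightarrow> bool" where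
  "design M \<Omega> e X \<longleftrightarrow>
     (\<forall>n. (\<forall>i<n. X n i \<in> borel_measurable M \<and> (\<forall>\<omega>\<in>space M. X n i \<omega> \<in> \<Omega>)) \<and>
          prob_space.indep_set M
            (sets (vimage_algebra (space M) (\<lambda>\<omega>. \<lambda>i\<in>{..<n}. X n i \<omega>) (Pi\<^sub>M {..<n} (\<lambda>_. borel))))
            (sets (vimage_algebra (space M) (\<lambda>\<omega>. \<lambda>i\<in>{..<n}. e i \<omega>) (Pi\<^sub>M {..<n} (\<lambda>_. borel)))))"

text \<open>The event \<open>\<Xi>\<^bsub>\<epsilon>\<^esub>\<close> for sample size \<open>n\<close>, with \<open>c = C\<^bsub>\<epsilon>\<^esub>\<close>.\<close>

definition comparison_event ::
  "'w measure \<Rightarrow> nat \<Rightarrow> real \<Rightarrow> point set \<Rightarrow> (point \<Rightarrow> real) set \<Rightarrow>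
   ((point \<Rightarrow> real) \<Rightarrow> (point \<Rightarrow> real) \<Rightarrow> real) \<Rightarrow> (nat \<Rightarrow> nat \<Rightarrow> 'w \<Rightarrow> point) \<Rightarrow>
   real \<Rightarrow> real \<Rightarrow> nat \<Rightarrow> 'w set" where
  "comparison_event M d m \<Omega> H ip X C1 c n =
     {\<omega> \<in> space M. \<forall>v\<in>H.
        L2_norm d \<Omega> v \<le>
          max (C1 * emp_norm n (\<lambda>i. X n i \<omega>) v)
              (c * real n powr (- (m / real d)) * ip_norm ip v) \<and>
        emp_norm n (\<lambda>i. X n i \<omega>) v \<le>
          max (C1 * L2_norm d \<Omega> v)
              (c * real n powr (- (m / real d)) * ip_norm ip v)}"

definition norm_comparison ::
  "'w measure \<Rightarrow> nat \<Rightarrow> real \<Rightarrow> point set \<Rightarrow> (point \<Rightarrow> real) set \<Rightarrow>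
   ((point \<Rightarrow> real) \<Rightarrow> (point \<Rightarrow> real) \<Rightarrow> real) \<Rightarrow> (nat \<Rightarrow> nat \<Rightarrow> 'w \<Rightarrow> point) \<Rightarrow>
   real \<Rightarrow> (real \<Rightarrow> real) \<Rightarrow> bool" where
  "norm_comparison M d m \<Omega> H ip X C1 C \<longleftrightarrow>
     C1 > 0 \<and>
     (\<forall>\<epsilon>>0. C \<epsilon> > 0 \<and>
        (\<forall>n\<ge>1. measure M (comparison_event M d m \<Omega> H ip X C1 (C \<epsilon>) n) \<ge> 1 - \<epsilon>))"

end

theory Submission
  imports Defs
begin

text \<open>
  Write \<open>\<langle>u, v\<rangle>\<^sub>n\<close> for the empirical inner product.  The estimator is linear in the data, so its
  pairing with \<open>g\<close> can be moved onto \<open>g\<close>: if \<open>h\<close> solves the regularised normal equations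
  \<open>\<langle>h, v\<rangle>\<^sub>n + \<lambda>\<langle>h, v\<rangle>\<^sub>H = \<langle>g, v\<rangle>\<^sub>H\<close> for all \<open>v \<in> H\<close>, then the error paired with \<open>g\<close> is a constant plus
  the average of \<open>h(x\<^sub>i) e\<^sub>i\<close>.  Hence the variance equals \<open>\<sigma>\<^sup>2 n\<^sup>-\<^sup>1 \<parallel>h\<parallel>\<^sub>n\<^sup>2\<close> (lemma \<open>krr_var_eq\<close>), and the
  theorem is a lower bound for \<open>\<parallel>h\<parallel>\<^sub>n\<close>.

  Put \<open>R = \<lambda>\<^bsup>-\<delta>/(2\<tau>)\<^esup>\<close> and test the equation with a near-extremal \<open>v\<close> of (ii) for this \<open>R\<close>.  The choice of
  \<open>A\<^sub>1\<close> gives \<open>\<parallel>v\<parallel>\<^sub>n \<le> C\<^sub>1 \<parallel>v\<parallel>\<^sub>L\<^sub>2\<close>, so by Cauchy-Schwarz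
  \<open>C\<^sub>0 R\<^bsup>1-\<tau>\<^esup> \<le> C\<^sub>1 \<parallel>h\<parallel>\<^sub>n + \<lambda> R \<parallel>h\<parallel>\<^sub>H\<close>.  If the last term is at most half of the left side, this is the
  bound.  Otherwise \<open>\<parallel>h\<parallel>\<^sub>H\<close> is large.  Testing with \<open>h\<close> itself and using (i) gives
  \<open>\<lambda> \<parallel>h\<parallel>\<^sub>H\<^sup>2 \<le> C\<^sub>g \<parallel>h\<parallel>\<^sub>L\<^sub>2\<^bsup>\<delta>\<^esup> \<parallel>h\<parallel>\<^sub>H\<^bsup>1-\<delta>\<^esup>\<close>, which then forces \<open>\<parallel>h\<parallel>\<^sub>L\<^sub>2\<close> above a constant multiple of
  \<open>\<lambda>\<^bsup>1/2\<^esup> \<parallel>h\<parallel>\<^sub>H\<close>.  As \<open>\<lambda>\<^bsup>1/2\<^esup>\<close> dominates \<open>n\<^bsup>-m/d\<^esup>\<close>, the norm comparison turns this into a lower bound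
  for \<open>\<parallel>h\<parallel>\<^sub>n\<close> by \<open>\<lambda>\<^bsup>1/2\<^esup> \<parallel>h\<parallel>\<^sub>H\<close>, that is, by \<open>\<lambda>\<^bsup>(\<delta>-1)/2\<^esup>\<close>.  This is at least of the order of \<open>R\<^bsup>1-\<tau>\<^esup>\<close>
  because \<open>\<lambda> \<le> 1\<close> and because (i) and (ii) together imply \<open>\<delta> \<le> \<tau>\<close>.  The two cases are lemma
  \<open>energy_comparison_lower_bound\<close>; in both, squaring gives \<open>R\<^bsup>2(1-\<tau>)\<^esup> = \<lambda>\<^bsup>\<delta>(\<tau>-1)/\<tau>\<^esup>\<close>.
\<close>

section \<open>Inner product arithmetic\<close>

context rkhs
begin

lemma diff_mem:
  assumes "v \<in> H" "w \<in> H"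
  shows "(\<lambda>x. v x - w x) \<in> H"
  using add_mem[OF assms(1) scale_mem[OF assms(2), of "-1"]] by simp

lemma ip_scale_right:
  assumes "v \<in> H" "w \<in> H"
  shows "ip w (\<lambda>x. c * v x) = c * ip w v"
  using ip_scale[OF assms] ip_commute[OF assms] ip_commute[OF scale_mem[OF assms(1)] assms(2)]
  by simp

lemma ip_add_right:
  assumes "u \<in> H" "v \<in> H" "w \<in> H"
  shows "ip w (\<lambda>x. u x + v x) = ip w u + ip w v"
  using ip_add[OF assms] ip_commute[OF assms(1,3)] ip_commute[OF assms(2,3)]
    ip_commute[OF add_mem[OF assms(1,2)] assms(3)]
  by simp

lemma ip_diff:
  assumes "u \<in> H" "v \<in> H" "w \<in> H"
  shows "ip (\<lambda>x. u x - v x) w = ip u w - ip v w"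
  using ip_add[OF assms(1) scale_mem[OF assms(2), of "-1"] assms(3)] ip_scale[OF assms(2,3), of "-1"]
  by simp

lemma ip_diff_right:
  assumes "u \<in> H" "v \<in> H" "w \<in> H"
  shows "ip w (\<lambda>x. u x - v x) = ip w u - ip w v"
  using ip_diff[OF assms] ip_commute[OF assms(1,3)] ip_commute[OF assms(2,3)]
    ip_commute[OF diff_mem[OF assms(1,2)] assms(3)]
  by simp

lemma ip_zero [simp]: "w \<in> H \<Longrightarrow> ip (\<lambda>_. 0) w = 0"
  using ip_scale[of w w 0] by simp

lemma ip_self_nonneg: "v \<in> H \<Longrightarrow> ip v v \<ge> 0"
  using ip_pos[of v] by (cases "v = (\<lambda>_. 0)") auto

lemma ip_norm_sq: "v \<in> H \<Longrightarrow> (ip_norm ip v)\<^sup>2 = ip v v"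
  by (simp add: ip_norm_def ip_self_nonneg)

lemma ip_norm_nonneg: "v \<in> H \<Longrightarrow> ip_norm ip v \<ge> 0"
  by (simp add: ip_norm_def ip_self_nonneg)

lemma ip_cauchy_schwarz:
  assumes u: "u \<in> H" and v: "v \<in> H"
  shows "ip u v \<le> ip_norm ip u * ip_norm ip v"
proof (cases "v = (\<lambda>_. 0)")
  case True
  then show ?thesis
    using u ip_commute[OF zero_mem u] by (simp add: ip_norm_def zero_mem)
next
  case False
  then have pos: "ip v v > 0"
    using ip_pos v by blast
  define t where "t = ip u v / ip v v"
  have tv: "(\<lambda>x. t * v x) \<in> H"
    by (rule scale_mem[OF v])
  have "0 \<le> ip (\<lambda>x. u x - t * v x) (\<lambda>x. u x - t * v x)"
    by (intro ip_self_nonneg diff_mem u tv)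
  also have "\<dots> = ip u u - 2 * t * ip u v + t\<^sup>2 * ip v v"
    using u v tv diff_mem[OF u tv] ip_commute[OF u v]
    by (simp add: ip_diff ip_diff_right ip_scale ip_scale_right power2_eq_square algebra_simps)
  also have "\<dots> = ip u u - (ip u v)\<^sup>2 / ip v v"
    using pos by (simp add: t_def power2_eq_square field_simps)
  finally have "(ip u v)\<^sup>2 \<le> ip u u * ip v v"
    using pos by (simp add: field_simps)
  then have "(ip u v)\<^sup>2 \<le> (ip_norm ip u * ip_norm ip v)\<^sup>2"
    by (simp add: power_mult_distrib ip_norm_sq u v)
  then show ?thesis
    by (rule power2_le_imp_le) (simp add: ip_norm_nonneg u v)
qed

section \<open>The regularised normal equations\<close>

abbreviation kernel_section :: "'x \<Rightarrow> 'x \<Rightarrow> real" where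
  "kernel_section y \<equiv> \<lambda>x. if x \<in> \<Omega> then K x y else 0"

text \<open>The weak form of \<open>(T + lam) u = w\<close>, where \<open>T\<close> is the empirical covariance operator
  \<open>u \<mapsto> (\<Sum>i<n. u (xs i) * K _ (xs i)) / n\<close>.  In this form no operator on \<open>H\<close> has to be defined.\<close>

definition ridge_solution ::
  "nat \<Rightarrow> real \<Rightarrow> (nat \<Rightarrow> 'x) \<Rightarrow> ('x \<Rightarrow> real) \<Rightarrow> ('x \<Rightarrow> real) \<Rightarrow> bool" where
  "ridge_solution n lam xs w u \<longleftrightarrow>
     u \<in> H \<and> (\<forall>v\<in>H. (\<Sum>i<n. u (xs i) * v (xs i)) / real n + lam * ip u v = ip w v)"

text \<open>The operator on the left side is \<open>c\<close> times the identity plus \<open>n\<close> rank-one terms, one for each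
  design point.  Induction on \<open>n\<close> adds them one at a time, with the Sherman-Morrison formula: if \<open>q\<close>
  solves for \<open>w\<close> and \<open>p\<close> solves for the kernel section at the new point, a multiple of \<open>p\<close> is
  subtracted from \<open>q\<close>.  The denominator \<open>1 + p (xs n)\<close> is positive because \<open>p (xs n)\<close> is the quadratic
  form of the old operator at \<open>p\<close>.\<close>

lemma ridge_equation_solvable:
  fixes n :: nat
  assumes "c > 0" and "\<And>i. i < n \<Longrightarrow> xs i \<in> \<Omega>" and "w \<in> H"
  shows "\<exists>u\<in>H. \<forall>v\<in>H. (\<Sum>i<n. u (xs i) * v (xs i)) + c * ip u v = ip w v"
  using assms(2,3)
proof (induction n arbitrary: w)
  case 0
  show ?case
    using assms(1) \<open>w \<in> H\<close> scale_mem[of w "1 / c"] ip_scale[of w _ "1 / c"]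
    by (intro bexI[of _ "\<lambda>x. (1 / c) * w x"]) auto
next
  case (Suc n)
  let ?k = "kernel_section (xs n)"
  have xn: "xs n \<in> \<Omega>" and k: "?k \<in> H"
    using Suc.prems(1) kernel_mem by auto
  have "\<exists>p\<in>H. \<forall>v\<in>H. (\<Sum>i<n. p (xs i) * v (xs i)) + c * ip p v = ip ?k v"
    using Suc.IH[OF _ k] Suc.prems(1) by simp
  then obtain p where p: "p \<in> H"
    and p_eq: "\<And>v. v \<in> H \<Longrightarrow> (\<Sum>i<n. p (xs i) * v (xs i)) + c * ip p v = ip ?k v"
    by blast
  have "\<exists>q\<in>H. \<forall>v\<in>H. (\<Sum>i<n. q (xs i) * v (xs i)) + c * ip q v = ip w v"
    using Suc.IH[OF _ Suc.prems(2)] Suc.prems(1) by simp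
  then obtain q where q: "q \<in> H"
    and q_eq: "\<And>v. v \<in> H \<Longrightarrow> (\<Sum>i<n. q (xs i) * v (xs i)) + c * ip q v = ip w v"
    by blast
  have k_eval: "ip ?k v = v (xs n)" if "v \<in> H" for v
    using reproducing[OF that xn] ip_commute[OF that k] by simp
  have "p (xs n) = (\<Sum>i<n. (p (xs i))\<^sup>2) + c * ip p p"
    using p_eq[OF p] k_eval[OF p] by (simp add: power2_eq_square)
  then have p_nonneg: "p (xs n) \<ge> 0"
    using assms(1) ip_self_nonneg[OF p] by (simp add: sum_nonneg)
  \<comment> \<open>The choice of \<open>t\<close> makes \<open>t\<close> the value of the corrected solution at the new point.\<close>
  define t where "t = q (xs n) / (1 + p (xs n))"
  have t: "q (xs n) - t * p (xs n) = t"
    using p_nonneg by (simp add: t_def field_simps)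
  have tp: "(\<lambda>x. t * p x) \<in> H"
    by (rule scale_mem[OF p])
  show ?case
  proof (intro bexI[of _ "\<lambda>x. q x - t * p x"] ballI)
    fix v assume v: "v \<in> H"
    have ip_u: "ip (\<lambda>x. q x - t * p x) v = ip q v - t * ip p v"
      using ip_diff[OF q tp v] ip_scale[OF p v, of t] by simp
    have "(\<Sum>i<n. (q (xs i) - t * p (xs i)) * v (xs i)) + c * ip (\<lambda>x. q x - t * p x) v
        = ((\<Sum>i<n. q (xs i) * v (xs i)) + c * ip q v)
          - t * ((\<Sum>i<n. p (xs i) * v (xs i)) + c * ip p v)"
      by (simp add: ip_u algebra_simps sum_subtractf sum_distrib_left)
    also have "\<dots> = ip w v - t * v (xs n)"
      by (simp add: q_eq p_eq k_eval v)
    finally show "(\<Sum>i<Suc n. (q (xs i) - t * p (xs i)) * v (xs i)) + c * ip (\<lambda>x. q x - t * p x) v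
        = ip w v"
      by (simp add: t)
  qed (rule diff_mem[OF q tp])
qed

lemma ex_ridge_solution:
  assumes "n \<ge> 1" "lam > 0" and "\<And>i. i < n \<Longrightarrow> xs i \<in> \<Omega>" and "w \<in> H"
  shows "\<exists>u. ridge_solution n lam xs w u"
proof -
  obtain u where u: "u \<in> H"
    and eq: "\<forall>v\<in>H. (\<Sum>i<n. u (xs i) * v (xs i)) + (lam * real n) * ip u v = ip (\<lambda>x. real n * w x) v"
    using ridge_equation_solvable[of "lam * real n" n xs "\<lambda>x. real n * w x"] assms scale_mem
    by auto
  have "(\<Sum>i<n. u (xs i) * v (xs i)) / real n + lam * ip u v = ip w v" if v: "v \<in> H" for v
  proof -
    have "(\<Sum>i<n. u (xs i) * v (xs i)) + (lam * real n) * ip u v = real n * ip w v"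
      using eq v ip_scale[OF assms(4) v] by simp
    then show ?thesis
      using assms(1) by (simp add: field_simps)
  qed
  with u show ?thesis
    by (auto simp: ridge_solution_def)
qed

text \<open>The data enter the normal equations of the estimator through this functional.\<close>

lemma ex_data_representer:
  fixes n :: nat
  assumes "\<And>i. i < n \<Longrightarrow> xs i \<in> \<Omega>"
  shows "\<exists>w\<in>H. \<forall>v\<in>H. ip w v = (\<Sum>i<n. ys i * v (xs i))"
  using assms
proof (induction n)
  case 0
  show ?case
    by (auto intro!: bexI[of _ "\<lambda>_. 0"] zero_mem)
next
  case (Suc n)
  then obtain w where w: "w \<in> H" "\<forall>v\<in>H. ip w v = (\<Sum>i<n. ys i * v (xs i))"
    by auto
  have k: "kernel_section (xs n) \<in> H"
    using Suc.prems kernel_mem by auto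
  have yk: "(\<lambda>x. ys n * kernel_section (xs n) x) \<in> H"
    by (rule scale_mem[OF k])
  show ?case
  proof (intro bexI ballI)
    show "(\<lambda>x. w x + ys n * kernel_section (xs n) x) \<in> H"
      by (rule add_mem[OF w(1) yk])
    fix v assume v: "v \<in> H"
    have "ip (kernel_section (xs n)) v = v (xs n)"
      using reproducing[OF v] ip_commute[OF v k] Suc.prems by simp
    then show "ip (\<lambda>x. w x + ys n * kernel_section (xs n) x) v = (\<Sum>i<Suc n. ys i * v (xs i))"
      using ip_add[OF w(1) yk v] ip_scale[OF k v, of "ys n"] w(2) v by simp
  qed
qed

section \<open>The estimator and its variance\<close>

text \<open>Completing the square around a solution \<open>u\<close> of the normal equations shows that the objective
  at \<open>v\<close> exceeds the one at \<open>u\<close> by at least \<open>lam\<close> times the squared norm of \<open>v - u\<close>.  So \<open>u\<close> is the only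
  minimiser, and it is the one that \<^const>\<open>arg_min\<close> picks.\<close>

lemma krr_normal_equation:
  assumes n: "n \<ge> 1" and lam: "lam > 0" and xs: "\<And>i. i < n \<Longrightarrow> xs i \<in> \<Omega>"
  shows "krr H ip n lam xs ys \<in> H"
    and "v \<in> H \<Longrightarrow>
      (\<Sum>i<n. krr H ip n lam xs ys (xs i) * v (xs i)) / real n + lam * ip (krr H ip n lam xs ys) v
        = (\<Sum>i<n. ys i * v (xs i)) / real n"
proof -
  obtain w where w: "w \<in> H" "\<forall>v\<in>H. ip w v = (\<Sum>i<n. (ys i / real n) * v (xs i))"
    using ex_data_representer[of n xs "\<lambda>i. ys i / real n"] xs by blast
  obtain u where "ridge_solution n lam xs w u"
    using ex_ridge_solution[of n lam xs w] n lam xs w(1) by blast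
  then have u: "u \<in> H"
    and eq: "\<And>v. v \<in> H \<Longrightarrow>
      (\<Sum>i<n. u (xs i) * v (xs i)) / real n + lam * ip u v = (\<Sum>i<n. ys i * v (xs i)) / real n"
    using w(2) by (auto simp: ridge_solution_def sum_divide_distrib)
  define J where
    "J = (\<lambda>v. (\<Sum>i<n. (ys i - v (xs i))\<^sup>2) / real n + lam * (ip_norm ip v)\<^sup>2)"
  have J_eq: "J v = J u + (\<Sum>i<n. (v (xs i) - u (xs i))\<^sup>2) / real n
                + lam * ip (\<lambda>x. v x - u x) (\<lambda>x. v x - u x)" if v: "v \<in> H" for v
  proof -
    define r where "r = (\<lambda>x. v x - u x)"
    have r: "r \<in> H" and v_eq: "v = (\<lambda>x. u x + r x)"
      unfolding r_def using diff_mem[OF v u] by auto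
    \<comment> \<open>The terms linear in \<open>r\<close> cancel by the normal equation tested with \<open>r\<close>.\<close>
    have "(\<Sum>i<n. (ys i - v (xs i))\<^sup>2) = (\<Sum>i<n. (ys i - u (xs i))\<^sup>2)
        - 2 * (\<Sum>i<n. ys i * r (xs i)) + 2 * (\<Sum>i<n. u (xs i) * r (xs i)) + (\<Sum>i<n. (r (xs i))\<^sup>2)"
      unfolding v_eq sum_distrib_left sum.distrib[symmetric] sum_subtractf[symmetric]
      by (rule sum.cong) (auto simp: power2_eq_square algebra_simps)
    then have "(\<Sum>i<n. (ys i - v (xs i))\<^sup>2) / real n = (\<Sum>i<n. (ys i - u (xs i))\<^sup>2) / real n
        - 2 * ((\<Sum>i<n. ys i * r (xs i)) / real n) + 2 * ((\<Sum>i<n. u (xs i) * r (xs i)) / real n)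
        + (\<Sum>i<n. (r (xs i))\<^sup>2) / real n"
      by (simp add: add_divide_distrib diff_divide_distrib)
    moreover have "ip v v = ip u u + 2 * ip u r + ip r r"
      unfolding v_eq using u r add_mem[OF u r] ip_commute[OF u r]
      by (simp add: ip_add ip_add_right)
    moreover have "(\<Sum>i<n. ys i * r (xs i)) / real n
        = (\<Sum>i<n. u (xs i) * r (xs i)) / real n + lam * ip u r"
      using eq[OF r] by simp
    ultimately have "J v = J u + (\<Sum>i<n. (r (xs i))\<^sup>2) / real n + lam * ip r r"
      unfolding J_def ip_norm_sq[OF v] ip_norm_sq[OF u]
      by (simp add: distrib_left)
    then show ?thesis
      by (simp add: r_def)
  qed
  have J_gap: "J u + lam * ip (\<lambda>x. v x - u x) (\<lambda>x. v x - u x) \<le> J v" if "v \<in> H" for v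
    using J_eq[OF that] by (simp add: sum_nonneg)
  have "krr H ip n lam xs ys = u"
    unfolding krr_def J_def[symmetric]
  proof (rule arg_minI[where Q = "\<lambda>z. z = u"])
    show "u \<in> H" by (rule u)
    show "\<not> J v < J u" if "v \<in> H" for v
      using J_gap[OF that] mult_nonneg_nonneg[OF _ ip_self_nonneg[OF diff_mem[OF that u]], of lam] lam
      by simp
    fix v assume v: "v \<in> H" and "\<forall>y. y \<in> H \<longrightarrow> \<not> J y < J v"
    then have "J v \<le> J u"
      using u by (simp add: not_less)
    then have "lam * ip (\<lambda>x. v x - u x) (\<lambda>x. v x - u x) \<le> 0"
      using J_gap[OF v] by simp
    then have "\<not> ip (\<lambda>x. v x - u x) (\<lambda>x. v x - u x) > 0"
      using lam by (simp add: mult_le_0_iff)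
    then have "(\<lambda>x. v x - u x) = (\<lambda>_. 0)"
      using ip_pos[OF diff_mem[OF v u]] by blast
    then show "v = u"
      by (simp add: fun_eq_iff)
  qed
  then show "krr H ip n lam xs ys \<in> H"
    and "v \<in> H \<Longrightarrow>
      (\<Sum>i<n. krr H ip n lam xs ys (xs i) * v (xs i)) / real n + lam * ip (krr H ip n lam xs ys) v
        = (\<Sum>i<n. ys i * v (xs i)) / real n"
    using u eq by auto
qed

text \<open>The duality step: the equation of \<open>h\<close> tested with the estimator and that of the estimator tested
  with \<open>h\<close> have the same left side.  So only the errors, weighted by the values of \<open>h\<close>, and a bias
  that does not depend on them remain.\<close>

lemma krr_error_linear:
  assumes n: "n \<ge> 1" and lam: "lam > 0" and xs: "\<And>i. i < n \<Longrightarrow> xs i \<in> \<Omega>"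
    and f: "f \<in> H" and g: "g \<in> H" and h: "ridge_solution n lam xs g h"
  shows "ip (\<lambda>x. krr H ip n lam xs (\<lambda>i. f (xs i) + e i) x - f x) g
    = (\<Sum>i<n. (h (xs i) / real n) * e i) + (- lam * ip h f)"
proof -
  define u where "u = krr H ip n lam xs (\<lambda>i. f (xs i) + e i)"
  have u: "u \<in> H"
    and eq: "\<And>v. v \<in> H \<Longrightarrow> (\<Sum>i<n. u (xs i) * v (xs i)) / real n + lam * ip u v
        = (\<Sum>i<n. (f (xs i) + e i) * v (xs i)) / real n"
    unfolding u_def using krr_normal_equation[of n lam xs] n lam xs by auto
  have hH: "h \<in> H"
    and h_eq: "\<And>v. v \<in> H \<Longrightarrow> (\<Sum>i<n. h (xs i) * v (xs i)) / real n + lam * ip h v = ip g v"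
    using h by (auto simp: ridge_solution_def)
  have "ip (\<lambda>x. u x - f x) g = ip g u - ip g f"
    using ip_diff[OF u f g] ip_commute g u f by simp
  also have "\<dots> = ((\<Sum>i<n. u (xs i) * h (xs i)) / real n + lam * ip u h)
      - ((\<Sum>i<n. f (xs i) * h (xs i)) / real n + lam * ip h f)"
    using h_eq[OF u] h_eq[OF f] ip_commute[OF hH u] by (simp add: mult.commute)
  also have "\<dots> = (\<Sum>i<n. e i * h (xs i)) / real n - lam * ip h f"
    unfolding eq[OF hH] by (simp add: distrib_right sum.distrib add_divide_distrib)
  finally show ?thesis
    by (simp add: u_def sum_divide_distrib mult.commute)
qed

end

lemma (in prob_space) variance_weighted_sum_errors:
  assumes "iid_errors M e \<sigma>"
  shows "variance (\<lambda>\<omega>. (\<Sum>i<n. a i * e i \<omega>) + b) = \<sigma>\<^sup>2 * (\<Sum>i<n. (a i)\<^sup>2)"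
proof -
  have indep: "indep_vars (\<lambda>_. borel) e UNIV"
    and int [simp]: "\<And>i. integrable M (e i)"
    and int2 [simp]: "\<And>i. integrable M (\<lambda>\<omega>. (e i \<omega>)\<^sup>2)"
    and mean [simp]: "\<And>i. expectation (e i) = 0"
    and "\<And>i. variance (e i) = \<sigma>\<^sup>2"
    using assms unfolding iid_errors_def by blast+
  then have var: "\<And>i. expectation (\<lambda>\<omega>. (e i \<omega>)\<^sup>2) = \<sigma>\<^sup>2"
    by simp
  have pair: "indep_var borel (e i) borel (e j)" if "i \<noteq> j" for i j
    using indep_vars_sum[of "{j}" i e] that indep_vars_subset[OF indep, of "{i, j}"] by simp
  have cross_int [simp]: "integrable M (\<lambda>\<omega>. e i \<omega> * e j \<omega>)" for i j
    using indep_var_integrable[OF pair[of i j]] int2[of i]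
    by (cases "i = j") (auto simp: power2_eq_square)
  have cross: "expectation (\<lambda>\<omega>. e i \<omega> * e j \<omega>) = (if i = j then \<sigma>\<^sup>2 else 0)" for i j
    using indep_var_lebesgue_integral[OF pair[of i j]] var[of i]
    by (cases "i = j") (auto simp: power2_eq_square)
  have "expectation (\<lambda>\<omega>. (\<Sum>i<n. a i * e i \<omega>) + b) = b"
    by (simp add: prob_space)
  then have "variance (\<lambda>\<omega>. (\<Sum>i<n. a i * e i \<omega>) + b) = expectation (\<lambda>\<omega>. (\<Sum>i<n. a i * e i \<omega>)\<^sup>2)"
    by (simp add: prob_space)
  also have "\<dots> = expectation (\<lambda>\<omega>. \<Sum>i<n. \<Sum>j<n. (a i * a j) * (e i \<omega> * e j \<omega>))"
    by (simp add: power2_eq_square sum_product mult_ac)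
  also have "\<dots> = (\<Sum>i<n. \<Sum>j<n. (a i * a j) * (if i = j then \<sigma>\<^sup>2 else 0))"
    by (simp add: cross)
  also have "\<dots> = \<sigma>\<^sup>2 * (\<Sum>i<n. (a i)\<^sup>2)"
    by (simp add: sum_distrib_left power2_eq_square mult_ac if_distrib[of "\<lambda>x. _ * x"] cong: if_cong)
  finally show ?thesis .
qed

text \<open>With \<open>h = n (K(X,X) + \<lambda>nI)\<^sup>-\<^sup>1 g(X)\<close> on the design, this is the usual formula
  \<open>\<sigma>\<^sup>2 g\<^sup>T(X) (K(X,X) + \<lambda>nI)\<^sup>-\<^sup>2 g(X)\<close>.\<close>

lemma krr_var_eq:
  assumes "rkhs \<Omega> K H ip" and "prob_space M" and "iid_errors M e \<sigma>"
    and n: "n \<ge> 1" and lam: "lam > 0" and xs: "\<And>i. i < n \<Longrightarrow> xs i \<in> \<Omega>"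
    and f: "f \<in> H" and g: "g \<in> H" and h: "rkhs.ridge_solution H ip n lam xs g h"
  shows "krr_var M e H ip n lam xs f g = \<sigma>\<^sup>2 * inverse (real n) * (emp_norm n xs h)\<^sup>2"
proof -
  interpret rkhs \<Omega> K H ip by fact
  interpret prob_space M by fact
  have linear: "ip (\<lambda>x. krr H ip n lam xs (\<lambda>i. f (xs i) + \<epsilon> i) x - f x) g
      = (\<Sum>i<n. (h (xs i) / real n) * \<epsilon> i) + (- lam * ip h f)" for \<epsilon> :: "nat \<Rightarrow> real"
    by (rule krr_error_linear[OF n lam _ f g h]) (rule xs)
  have "krr_var M e H ip n lam xs f g = \<sigma>\<^sup>2 * (\<Sum>i<n. (h (xs i) / real n)\<^sup>2)"
    unfolding krr_var_def linear
    by (rule variance_weighted_sum_errors[OF assms(3)])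
  also have "(\<Sum>i<n. (h (xs i) / real n)\<^sup>2) = inverse (real n) * (emp_norm n xs h)\<^sup>2"
    by (simp add: emp_norm_def sum_nonneg power_divide sum_divide_distrib[symmetric]
        power2_eq_square field_simps)
  finally show ?thesis by simp
qed

section \<open>The lower bound for the smoothed functional\<close>

lemma emp_cauchy_schwarz:
  "(\<Sum>i<n. u (xs i) * v (xs i)) / real n \<le> emp_norm n xs u * emp_norm n xs v"
proof -
  have "(\<Sum>i<n. u (xs i) * v (xs i))
      \<le> sqrt ((\<Sum>i<n. (u (xs i))\<^sup>2) * (\<Sum>i<n. (v (xs i))\<^sup>2))"
    by (rule real_le_rsqrt) (rule Cauchy_Schwarz_ineq_sum)
  then show ?thesis
    by (simp add: emp_norm_def real_sqrt_divide real_sqrt_mult divide_right_mono)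
qed

lemma powr_domination_exponents_le:
  fixes \<delta> \<tau> :: real
  assumes "C\<^sub>0 > 0" and bound: "\<And>R. R \<ge> R\<^sub>0 \<Longrightarrow> C\<^sub>0 * R powr (1 - \<tau>) \<le> C\<^sub>g * R powr (1 - \<delta>)"
  shows "\<delta> \<le> \<tau>"
proof (rule ccontr)
  assume "\<not> \<delta> \<le> \<tau>"
  then have pos: "\<delta> - \<tau> > 0" by simp
  define B where "B = \<bar>C\<^sub>g\<bar> / C\<^sub>0 + 1"
  define R where "R = max R\<^sub>0 (B powr (1 / (\<delta> - \<tau>)))"
  have B: "B > C\<^sub>g / C\<^sub>0" "B > 0"
    using assms(1) by (auto simp: B_def add_nonneg_pos field_simps)
  then have "B powr (1 / (\<delta> - \<tau>)) > 0"
    by simp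
  then have R_ge: "R \<ge> R\<^sub>0" "R \<ge> B powr (1 / (\<delta> - \<tau>))" "R > 0"
    by (auto simp: R_def less_max_iff_disj)
  have "B = (B powr (1 / (\<delta> - \<tau>))) powr (\<delta> - \<tau>)"
    using B pos by (simp add: powr_powr)
  also have "\<dots> \<le> R powr (\<delta> - \<tau>)"
    using R_ge pos by (intro powr_mono2) auto
  finally have R: "R powr (\<delta> - \<tau>) > C\<^sub>g / C\<^sub>0" "R \<ge> R\<^sub>0" "R > 0"
    using B R_ge by auto
  have "C\<^sub>g * R powr (1 - \<delta>) < C\<^sub>0 * R powr (\<delta> - \<tau>) * R powr (1 - \<delta>)"
    using R assms(1) by (simp add: field_simps)
  also have "\<dots> = C\<^sub>0 * R powr (1 - \<tau>)"
    by (simp add: powr_add[symmetric])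
  finally show False
    using bound[OF R(2)] by simp
qed

text \<open>The analytic core, with \<open>s\<close>, \<open>N\<close> and \<open>L\<close> in the roles of the empirical, the \<open>H\<close>- and the \<open>L\<^sub>2\<close>-norm
  of \<open>h\<close>.  The exponent in \<open>R\<close> is the one for which a regularisation term \<open>lam * R * N\<close> that matters
  means \<open>lam * N\<close> at least of the order \<open>lam powr (\<delta> / 2)\<close>; by the energy inequality \<open>L / N\<close> is then at
  least \<open>k * lam powr (1 / 2)\<close>.  That excludes the second alternative of the norm comparison, so \<open>L\<close>
  bounds \<open>s\<close> from below.\<close>

lemma energy_comparison_lower_bound:
  fixes C\<^sub>0 C\<^sub>1 C\<^sub>g \<delta> \<tau> lam q R s N L :: real
  assumes pos: "C\<^sub>0 > 0" "C\<^sub>1 > 0" "C\<^sub>g > 0" "\<delta> > 0" "\<delta> \<le> \<tau>" and lam: "0 < lam" "lam \<le> 1"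
    and nonneg: "s \<ge> 0" "N \<ge> 0" "L \<ge> 0"
    and R: "R = lam powr (- \<delta> / (2 * \<tau>))"
    and k: "k = (C\<^sub>0 / (2 * C\<^sub>g)) powr (1 / \<delta>)"
    and q: "q \<le> k * lam powr (1 / 2)"
    and energy: "lam * N\<^sup>2 \<le> C\<^sub>g * L powr \<delta> * N powr (1 - \<delta>)"
    and compare: "L \<le> max (C\<^sub>1 * s) (q * N)"
    and pairing: "C\<^sub>0 * R powr (1 - \<tau>) \<le> C\<^sub>1 * s + lam * R * N"
  shows "s \<ge> C\<^sub>0 / (2 * C\<^sub>1) * min 1 k * R powr (1 - \<tau>)"
proof (cases "lam * R * N \<le> C\<^sub>0 / 2 * R powr (1 - \<tau>)")
  case True
  then have "C\<^sub>0 / 2 * R powr (1 - \<tau>) \<le> C\<^sub>1 * s"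
    using pairing by simp
  then have "C\<^sub>0 / (2 * C\<^sub>1) * R powr (1 - \<tau>) \<le> s"
    using pos by (simp add: field_simps)
  moreover have "C\<^sub>0 / (2 * C\<^sub>1) * min 1 k * R powr (1 - \<tau>) \<le> C\<^sub>0 / (2 * C\<^sub>1) * 1 * R powr (1 - \<tau>)"
    using pos by (intro mult_right_mono mult_left_mono) auto
  ultimately show ?thesis by simp
next
  case False
  have \<tau>: "\<tau> > 0" and R_pos: "R > 0" and k_pos: "k > 0"
    using pos lam by (auto simp: R k)
  have R\<tau>: "R powr \<tau> * lam powr (\<delta> / 2) = 1"
    using lam \<tau> by (simp add: R powr_powr powr_add[symmetric])
  \<comment> \<open>Rewrite the case assumption without \<open>R\<close>.\<close>
  have "lam * R * N * R powr (\<tau> - 1) > C\<^sub>0 / 2 * R powr (1 - \<tau>) * R powr (\<tau> - 1)"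
    using False R_pos by (intro mult_strict_right_mono) auto
  moreover have "lam * R * N * R powr (\<tau> - 1) = lam * N * R powr \<tau>"
    using powr_mult_base[of R "\<tau> - 1"] R_pos by (simp add: mult.assoc mult.left_commute)
  moreover have "C\<^sub>0 / 2 * R powr (1 - \<tau>) * R powr (\<tau> - 1) = C\<^sub>0 / 2"
    using R_pos by (simp add: mult.assoc powr_add[symmetric])
  ultimately have "lam * N * R powr \<tau> > C\<^sub>0 / 2"
    by linarith
  then have "lam * N * R powr \<tau> * lam powr (\<delta> / 2) > C\<^sub>0 / 2 * lam powr (\<delta> / 2)"
    using lam by (intro mult_strict_right_mono) auto
  then have N_large: "lam * N > C\<^sub>0 / 2 * lam powr (\<delta> / 2)"
    using R\<tau> by (simp add: mult.assoc)
  moreover have "C\<^sub>0 / 2 * lam powr (\<delta> / 2) > 0"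
    using pos lam by simp
  ultimately have N: "N > 0"
    using lam by (metis less_trans zero_less_mult_pos)
  \<comment> \<open>Cancel \<open>N powr (1 - \<delta>)\<close> in the energy inequality and insert the lower bound for \<open>lam * N\<close>.\<close>
  have "lam * N * (N powr \<delta> * N powr (1 - \<delta>)) \<le> C\<^sub>g * L powr \<delta> * N powr (1 - \<delta>)"
    using energy N by (simp add: powr_add[symmetric] power2_eq_square)
  then have "lam * N * N powr \<delta> \<le> C\<^sub>g * L powr \<delta>"
    using N by (simp add: mult.assoc[symmetric])
  then have "C\<^sub>0 / 2 * lam powr (\<delta> / 2) * N powr \<delta> < C\<^sub>g * L powr \<delta>"
    using N_large N by (intro less_le_trans[OF mult_strict_right_mono[OF N_large]]) auto
  then have "C\<^sub>0 / (2 * C\<^sub>g) * lam powr (\<delta> / 2) * N powr \<delta> < L powr \<delta>"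
    using pos by (simp add: field_simps)
  moreover have "(k * lam powr (1 / 2) * N) powr \<delta> = C\<^sub>0 / (2 * C\<^sub>g) * lam powr (\<delta> / 2) * N powr \<delta>"
    using pos lam N k_pos by (simp add: powr_mult powr_powr k)
  ultimately have L_large: "k * lam powr (1 / 2) * N < L"
    using powr_less_cancel2[of \<delta> "k * lam powr (1 / 2) * N" L] pos lam N k_pos nonneg
    by (metis linorder_not_le powr_mono2 less_imp_le mult_nonneg_nonneg powr_ge_zero)
  moreover have "q * N \<le> k * lam powr (1 / 2) * N"
    using q N by (intro mult_right_mono) auto
  ultimately have "L \<le> C\<^sub>1 * s"
    using compare by auto
  then have "k * lam powr (1 / 2) * N \<le> C\<^sub>1 * s"
    using L_large by simp
  \<comment> \<open>The powers of \<open>lam\<close> match up to \<open>lam powr (1 / 2) \<le> inverse R\<close>, which is where \<open>\<delta> \<le> \<tau>\<close> enters.\<close>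
  moreover have "C\<^sub>0 / 2 * R powr (1 - \<tau>) \<le> lam powr (1 / 2) * N"
  proof -
    have "R \<le> lam powr (- 1 / 2)"
      unfolding R using lam pos \<tau> by (intro powr_mono') (auto simp: field_simps)
    moreover have "R powr (1 - \<tau>) = R * lam powr (\<delta> / 2)"
    proof -
      have "R powr (1 - \<tau>) = R powr 1 * R powr (- \<tau>)"
        by (simp only: powr_add[symmetric]) simp
      also have "R powr (- \<tau>) = lam powr (\<delta> / 2)"
        using \<tau> by (simp add: R powr_powr)
      finally show ?thesis using R_pos by simp
    qed
    ultimately have "C\<^sub>0 / 2 * R powr (1 - \<tau>) \<le> C\<^sub>0 / 2 * (lam powr (- 1 / 2) * lam powr (\<delta> / 2))"
      using pos by (intro mult_left_mono) (auto intro: mult_right_mono)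
    also have "\<dots> = lam powr (- 1 / 2) * (C\<^sub>0 / 2 * lam powr (\<delta> / 2))"
      by simp
    also have "\<dots> \<le> lam powr (- 1 / 2) * (lam * N)"
      using N_large by (intro mult_left_mono) auto
    also have "\<dots> = lam powr (1 / 2) * N"
      using lam powr_mult_base[of lam "- 1 / 2"] by (simp add: mult_ac)
    finally show ?thesis .
  qed
  ultimately have "k * (C\<^sub>0 / 2 * R powr (1 - \<tau>)) \<le> C\<^sub>1 * s"
    using k_pos by (smt (verit) mult.assoc mult_left_mono)
  then have "C\<^sub>0 / (2 * C\<^sub>1) * k * R powr (1 - \<tau>) \<le> s"
    using pos by (simp add: field_simps)
  moreover have "C\<^sub>0 / (2 * C\<^sub>1) * min 1 k * R powr (1 - \<tau>) \<le> C\<^sub>0 / (2 * C\<^sub>1) * k * R powr (1 - \<tau>)"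
    using pos by (intro mult_right_mono mult_left_mono) auto
  ultimately show ?thesis by simp
qed

text \<open>Here \<open>L\<close> can be any nonnegative functional that is compared with the empirical norm, and \<open>q\<close>
  stands for \<open>C\<^sub>\<epsilon> n\<^bsup>-m/d\<^esup>\<close>.  The bound \<open>q \<le> k * lam powr (1 / 2)\<close> is for \<open>h\<close>; the bound with \<open>C\<^sub>1\<close> gives
  \<open>q * R \<le> C\<^sub>1\<close>, so that the empirical norm of the test function \<open>v\<close> is at most \<open>C\<^sub>1 * L v\<close>.\<close>

lemma (in rkhs) ridge_solution_norm_lower_bound:
  fixes L :: "('x \<Rightarrow> real) \<Rightarrow> real" and C\<^sub>0 C\<^sub>1 C\<^sub>g \<delta> \<tau> lam q R :: real
  assumes pos: "C\<^sub>0 > 0" "C\<^sub>1 > 0" "C\<^sub>g > 0" "\<delta> > 0" "\<delta> \<le> \<tau>" and lam: "0 < lam" "lam \<le> 1"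
    and R: "R = lam powr (- \<delta> / (2 * \<tau>))"
    and k: "k = (C\<^sub>0 / (2 * C\<^sub>g)) powr (1 / \<delta>)"
    and q: "0 \<le> q" "q \<le> min k C\<^sub>1 * lam powr (1 / 2)"
    and L_nonneg: "\<And>v. L v \<ge> 0"
    and L_le: "\<And>v. v \<in> H \<Longrightarrow> L v \<le> max (C\<^sub>1 * emp_norm n xs v) (q * ip_norm ip v)"
    and emp_le: "\<And>v. v \<in> H \<Longrightarrow> emp_norm n xs v \<le> max (C\<^sub>1 * L v) (q * ip_norm ip v)"
    and g: "\<And>v. v \<in> H \<Longrightarrow> \<bar>ip g v\<bar> \<le> C\<^sub>g * L v powr \<delta> * ip_norm ip v powr (1 - \<delta>)"
    and v: "v \<in> H" "ip_norm ip v \<le> R * L v" "C\<^sub>0 * R powr (1 - \<tau>) < ip g v / L v"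
    and h: "ridge_solution n lam xs g h"
  shows "emp_norm n xs h \<ge> C\<^sub>0 / (2 * C\<^sub>1) * min 1 k * R powr (1 - \<tau>)"
proof (rule energy_comparison_lower_bound[OF pos lam _ _ L_nonneg R k])
  have hH: "h \<in> H"
    and h_eq: "\<And>w. w \<in> H \<Longrightarrow> (\<Sum>i<n. h (xs i) * w (xs i)) / real n + lam * ip h w = ip g w"
    using h by (auto simp: ridge_solution_def)
  show s: "emp_norm n xs h \<ge> 0"
    by (simp add: emp_norm_def sum_nonneg)
  show N: "ip_norm ip h \<ge> 0"
    by (rule ip_norm_nonneg[OF hH])
  have root: "lam powr (1 / 2) > 0"
    using lam by simp
  show "q \<le> k * lam powr (1 / 2)"
    using q(2) root by (smt (verit) min.cobounded1 mult_right_mono)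
  have "lam * (ip_norm ip h)\<^sup>2 \<le> (\<Sum>i<n. h (xs i) * h (xs i)) / real n + lam * ip h h"
    by (simp add: ip_norm_sq[OF hH] sum_nonneg)
  then show "lam * (ip_norm ip h)\<^sup>2 \<le> C\<^sub>g * L h powr \<delta> * ip_norm ip h powr (1 - \<delta>)"
    using g[OF hH] h_eq[OF hH] by simp
  show "L h \<le> max (C\<^sub>1 * emp_norm n xs h) (q * ip_norm ip h)"
    by (rule L_le[OF hH])
  have "0 \<le> C\<^sub>0 * R powr (1 - \<tau>)"
    using pos by simp
  then have Lv: "L v > 0"
    using v(3) L_nonneg[of v] by (cases "L v = 0") auto
  have "R \<le> lam powr (- 1 / 2)"
    unfolding R using lam pos by (intro powr_mono') (auto simp: field_simps)
  then have "q * R \<le> (C\<^sub>1 * lam powr (1 / 2)) * lam powr (- 1 / 2)"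
    using q root pos by (intro mult_mono) (smt (verit) min.cobounded2 mult_right_mono, auto simp: R)
  also have "\<dots> = C\<^sub>1"
    using lam by (simp add: mult.assoc powr_add[symmetric])
  finally have qR: "q * R \<le> C\<^sub>1" .
  have "q * ip_norm ip v \<le> q * R * L v"
    using mult_left_mono[OF v(2) q(1)] by (simp add: mult.assoc)
  also have "\<dots> \<le> C\<^sub>1 * L v"
    using qR Lv by (intro mult_right_mono) auto
  finally have emp_v: "emp_norm n xs v \<le> C\<^sub>1 * L v"
    using emp_le[OF v(1)] by simp
  have "C\<^sub>0 * R powr (1 - \<tau>) * L v \<le> ip g v"
    using v(3) Lv by (simp add: field_simps)
  also have "\<dots> \<le> emp_norm n xs h * emp_norm n xs v + lam * (ip_norm ip h * ip_norm ip v)"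
    unfolding h_eq[OF v(1), symmetric]
    using lam by (intro add_mono emp_cauchy_schwarz mult_left_mono ip_cauchy_schwarz hH v) auto
  also have "\<dots> \<le> emp_norm n xs h * (C\<^sub>1 * L v) + lam * (ip_norm ip h * (R * L v))"
    using lam s N emp_v v(2) by (intro add_mono mult_left_mono) auto
  also have "\<dots> = (C\<^sub>1 * emp_norm n xs h + lam * R * ip_norm ip h) * L v"
    by (simp add: algebra_simps)
  finally show "C\<^sub>0 * R powr (1 - \<tau>) \<le> C\<^sub>1 * emp_norm n xs h + lam * R * ip_norm ip h"
    using Lv by simp
qed

text \<open>For \<open>v\<close> with norm at most \<open>R * L v\<close>, the upper bound on the functional limits \<open>ip g v / L v\<close> to
  \<open>C\<^sub>g * R powr (1 - \<delta>)\<close>.  The lower bound for large \<open>R\<close> is compatible with this only if it grows no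
  faster.\<close>

lemma (in rkhs) upper_exponent_le_lower_exponent:
  fixes L :: "('x \<Rightarrow> real) \<Rightarrow> real" and C\<^sub>0 C\<^sub>g R\<^sub>0 \<delta> \<tau> :: real
  assumes "C\<^sub>0 > 0" "C\<^sub>g > 0" "\<delta> \<le> 1" and L_nonneg: "\<And>v. L v \<ge> 0"
    and g: "\<And>v. v \<in> H \<Longrightarrow> \<bar>ip g v\<bar> \<le> C\<^sub>g * L v powr \<delta> * ip_norm ip v powr (1 - \<delta>)"
    and test: "\<And>R. R \<ge> R\<^sub>0 \<Longrightarrow>
      \<exists>v\<in>H. ip_norm ip v \<le> R * L v \<and> C\<^sub>0 * R powr (1 - \<tau>) < ip g v / L v"
  shows "\<delta> \<le> \<tau>"
proof (rule powr_domination_exponents_le[OF \<open>C\<^sub>0 > 0\<close>])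
  fix R assume "R \<ge> R\<^sub>0"
  then obtain v where v: "v \<in> H" "ip_norm ip v \<le> R * L v" "C\<^sub>0 * R powr (1 - \<tau>) < ip g v / L v"
    using test by blast
  have "0 \<le> C\<^sub>0 * R powr (1 - \<tau>)"
    using assms(1) by simp
  then have Lv: "L v > 0"
    using v(3) L_nonneg[of v] by (cases "L v = 0") auto
  have "0 \<le> R * L v"
    using v(2) ip_norm_nonneg[OF v(1)] by simp
  then have R: "R \<ge> 0"
    using Lv by (simp add: zero_le_mult_iff)
  have "ip g v \<le> C\<^sub>g * L v powr \<delta> * ip_norm ip v powr (1 - \<delta>)"
    using g[OF v(1)] by simp
  also have "\<dots> \<le> C\<^sub>g * L v powr \<delta> * (R * L v) powr (1 - \<delta>)"
    using v ip_norm_nonneg assms by (intro mult_left_mono powr_mono2) auto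
  also have "\<dots> = C\<^sub>g * R powr (1 - \<delta>) * (L v powr \<delta> * L v powr (1 - \<delta>))"
    using R Lv by (simp add: powr_mult mult_ac)
  also have "\<dots> = C\<^sub>g * R powr (1 - \<delta>) * L v"
    using Lv by (simp add: powr_add[symmetric])
  finally have "ip g v / L v \<le> C\<^sub>g * R powr (1 - \<delta>)"
    using Lv by (simp add: field_simps)
  then show "C\<^sub>0 * R powr (1 - \<tau>) \<le> C\<^sub>g * R powr (1 - \<delta>)"
    using v(3) by simp
qed

theorem theorem2:
  fixes C\<^sub>0 C\<^sub>1 C\<^sub>g C\<^sub>\<epsilon> R\<^sub>0 \<delta> \<tau> :: real
  assumes "C\<^sub>0 > 0" "C\<^sub>1 > 0" "C\<^sub>g > 0" "C\<^sub>\<epsilon> > 0" "R\<^sub>0 > 0"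
    and "0 < \<delta>" "\<delta> \<le> 1" "0 < \<tau>" "\<tau> \<le> 1"
  shows "\<exists>A\<^sub>1>0. \<exists>A\<^sub>2>0. \<exists>A\<^sub>3>0.
    \<forall>(d :: nat) (m :: real) (\<Omega> :: point set) K H ip
      (M :: 'w measure) (e :: nat \<Rightarrow> 'w \<Rightarrow> real) (\<sigma> :: real) X (C :: real \<Rightarrow> real) f g (\<epsilon> :: real).
      d \<ge> 1 \<and> m > real d / 2 \<and>
      convex_Rd \<Omega> \<and> compactin (Euclidean_space d) \<Omega> \<and>
      Euclidean_space d interior_of \<Omega> \<noteq> {} \<and>
      rkhs \<Omega> K H ip \<and> equal_sobolev d m \<Omega> H ip \<and>
      prob_space M \<and> iid_errors M e \<sigma> \<and> design M \<Omega> e X \<and>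
      norm_comparison M d m \<Omega> H ip X C\<^sub>1 C \<and>
      f \<in> H \<and> g \<in> H \<and>
      (\<forall>v\<in>H. \<bar>ip g v\<bar> \<le> C\<^sub>g * L2_norm d \<Omega> v powr \<delta> * ip_norm ip v powr (1 - \<delta>)) \<and>
      (\<forall>R\<ge>R\<^sub>0. (SUP v \<in> {v \<in> H. ip_norm ip v \<le> R * L2_norm d \<Omega> v}.
                   ereal (ip g v / L2_norm d \<Omega> v)) > ereal (C\<^sub>0 * R powr (1 - \<tau>))) \<and>
      \<epsilon> > 0 \<and> C \<epsilon> = C\<^sub>\<epsilon>
      \<longrightarrow>
      (\<forall>(n :: nat) (lam :: real). n \<ge> 1 \<and>
         A\<^sub>1 * real n powr (- 2 * m / real d) \<le> lam \<and> lam \<le> A\<^sub>2 \<longrightarrow>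
         (\<forall>\<omega> \<in> comparison_event M d m \<Omega> H ip X C\<^sub>1 C\<^sub>\<epsilon> n.
            krr_var M e H ip n lam (\<lambda>i. X n i \<omega>) f g
              \<ge> A\<^sub>3 * \<sigma>\<^sup>2 * inverse (real n) * lam powr (\<delta> * (\<tau> - 1) / \<tau>)))"
proof -
  \<comment> \<open>\<open>A\<^sub>1\<close> makes \<open>C\<^sub>\<epsilon> n\<^bsup>-m/d\<^esup>\<close> at most \<open>min k C\<^sub>1 * lam powr (1 / 2)\<close>, and \<open>A\<^sub>2\<close> gives \<open>lam \<le> 1\<close> and \<open>R \<ge> R\<^sub>0\<close>.\<close>
  define k where "k = (C\<^sub>0 / (2 * C\<^sub>g)) powr (1 / \<delta>)"
  define b where "b = C\<^sub>0 / (2 * C\<^sub>1) * min 1 k"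
  define A\<^sub>1 where "A\<^sub>1 = (C\<^sub>\<epsilon> / min k C\<^sub>1)\<^sup>2"
  define A\<^sub>2 where "A\<^sub>2 = min 1 (R\<^sub>0 powr (- (2 * \<tau> / \<delta>)))"
  have k_pos: "k > 0"
    using assms by (simp add: k_def)
  then have "min k C\<^sub>1 > 0" and b_pos: "b > 0"
    using assms by (auto simp: b_def)
  then have A1: "A\<^sub>1 > 0" and A2: "A\<^sub>2 > 0"
    using assms by (auto simp: A\<^sub>1_def A\<^sub>2_def)
  have main: "krr_var M e H ip n lam (\<lambda>i. X n i \<omega>) f g
      \<ge> b\<^sup>2 * \<sigma>\<^sup>2 * inverse (real n) * lam powr (\<delta> * (\<tau> - 1) / \<tau>)"
    if rk: "rkhs \<Omega> K H ip" and M: "prob_space M" and e: "iid_errors M e \<sigma>"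
      and X: "design M \<Omega> e X" and f: "f \<in> H" and g: "g \<in> H"
      and upper: "\<forall>v\<in>H. \<bar>ip g v\<bar> \<le> C\<^sub>g * L2_norm d \<Omega> v powr \<delta> * ip_norm ip v powr (1 - \<delta>)"
      and lower: "\<forall>R\<ge>R\<^sub>0. (SUP v \<in> {v \<in> H. ip_norm ip v \<le> R * L2_norm d \<Omega> v}.
                   ereal (ip g v / L2_norm d \<Omega> v)) > ereal (C\<^sub>0 * R powr (1 - \<tau>))"
      and n: "n \<ge> 1" and lam_ge: "A\<^sub>1 * real n powr (- 2 * m / real d) \<le> lam" and lam_le: "lam \<le> A\<^sub>2"
      and \<omega>: "\<omega> \<in> comparison_event M d m \<Omega> H ip X C\<^sub>1 C\<^sub>\<epsilon> n"
    for d n :: nat and m lam \<sigma> :: real and \<Omega> K H ip X f g \<omega>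
      and M :: "'w measure" and e :: "nat \<Rightarrow> 'w \<Rightarrow> real"
  proof -
    interpret rkhs \<Omega> K H ip by (rule rk)
    define xs where "xs = (\<lambda>i. X n i \<omega>)"
    define q where "q = C\<^sub>\<epsilon> * real n powr (- (m / real d))"
    define R where "R = lam powr (- \<delta> / (2 * \<tau>))"
    have "A\<^sub>1 * real n powr (- 2 * m / real d) > 0"
      using A1 n by simp
    then have lam: "lam > 0" "lam \<le> 1"
      using lam_ge lam_le by (auto simp: A\<^sub>2_def)
    have xs: "xs i \<in> \<Omega>" if "i < n" for i
      using X \<omega> that by (auto simp: design_def comparison_event_def xs_def)
    have L2: "L2_norm d \<Omega> v \<ge> 0" for v
      by (auto simp: L2_norm_def set_lebesgue_integral_def intro!: integral_nonneg_AE)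
    have test: "\<exists>v\<in>H. ip_norm ip v \<le> R * L2_norm d \<Omega> v
        \<and> C\<^sub>0 * R powr (1 - \<tau>) < ip g v / L2_norm d \<Omega> v" if "R \<ge> R\<^sub>0" for R
      using lower that by (auto simp: less_SUP_iff)
    have exponents: "\<delta> \<le> \<tau>"
      using upper by (intro upper_exponent_le_lower_exponent[OF assms(1,3,7) L2 _ test]) auto
    have "R\<^sub>0 = (R\<^sub>0 powr (- (2 * \<tau> / \<delta>))) powr (- \<delta> / (2 * \<tau>))"
      using assms by (simp add: powr_powr)
    also have "\<dots> \<le> R"
      unfolding R_def using assms lam lam_le by (intro powr_mono2') (auto simp: A\<^sub>2_def)
    finally obtain v where v: "v \<in> H" "ip_norm ip v \<le> R * L2_norm d \<Omega> v"
        "C\<^sub>0 * R powr (1 - \<tau>) < ip g v / L2_norm d \<Omega> v"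
      using test by blast
    have "(q / min k C\<^sub>1)\<^sup>2 = A\<^sub>1 * real n powr (- 2 * m / real d)"
      using n by (simp add: q_def A\<^sub>1_def power_mult_distrib power_divide powr_power)
    then have "q / min k C\<^sub>1 \<le> sqrt lam"
      using lam_ge by (intro real_le_rsqrt) simp
    then have q: "q \<le> min k C\<^sub>1 * lam powr (1 / 2)"
      using lam k_pos assms(2) by (simp add: powr_half_sqrt divide_le_eq mult.commute)
    have q_nonneg: "0 \<le> q"
      using assms(4) by (simp add: q_def)
    obtain h where h: "ridge_solution n lam xs g h"
      using ex_ridge_solution[of n lam xs g] n lam(1) xs g by blast
    have "b * R powr (1 - \<tau>) \<le> emp_norm n xs h"
      unfolding b_def
      using \<omega> upper
      by (intro ridge_solution_norm_lower_bound[where L = "L2_norm d \<Omega>", OF assms(1-3) assms(6) exponents lam R_def k_def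
            q_nonneg q L2 _ _ _ v h])
        (auto simp: comparison_event_def xs_def q_def)
    then have "(b * R powr (1 - \<tau>))\<^sup>2 \<le> (emp_norm n xs h)\<^sup>2"
      using b_pos by (intro power_mono) auto
    moreover have "(R powr (1 - \<tau>))\<^sup>2 = lam powr (\<delta> * (\<tau> - 1) / \<tau>)"
    proof -
      have "(R powr (1 - \<tau>))\<^sup>2 = lam powr (- \<delta> / (2 * \<tau>) * (1 - \<tau>) + - \<delta> / (2 * \<tau>) * (1 - \<tau>))"
        by (simp only: R_def powr_powr power2_eq_square powr_add)
      also have "- \<delta> / (2 * \<tau>) * (1 - \<tau>) + - \<delta> / (2 * \<tau>) * (1 - \<tau>) = \<delta> * (\<tau> - 1) / \<tau>"
        using assms(8) by (simp add: field_simps)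
      finally show ?thesis .
    qed
    ultimately have "b\<^sup>2 * lam powr (\<delta> * (\<tau> - 1) / \<tau>) \<le> (emp_norm n xs h)\<^sup>2"
      by (simp add: power_mult_distrib)
    then have "\<sigma>\<^sup>2 * inverse (real n) * (b\<^sup>2 * lam powr (\<delta> * (\<tau> - 1) / \<tau>))
        \<le> \<sigma>\<^sup>2 * inverse (real n) * (emp_norm n xs h)\<^sup>2"
      by (intro mult_left_mono) auto
    also have "\<dots> = krr_var M e H ip n lam (\<lambda>i. X n i \<omega>) f g"
      using krr_var_eq[OF rk M e n lam(1) xs f g h] by (simp add: xs_def)
    finally show ?thesis
      by (simp add: mult_ac)
  qed
  show ?thesis
    using A1 A2 b_pos
    by (intro exI[of _ A\<^sub>1] exI[of _ A\<^sub>2] exI[of _ "b\<^sup>2"] conjI allI impI ballI)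
      (auto intro!: main)
qed

end
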